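(* A magma $M$ is free if and only if it is graded and unidecomposable.
   Context: A magma is a set $M$ with a binary operation $+:M\times M\to M$ (no axioms). Let $\mathbb{N}$ be the set of strictly positive integers. A gradation of $M$ is a map $\tilde\ell:M\to\mathbb{N}$ with $\tilde\ell(x+y)=\tilde\ell(x)+\tilde\ell(y)$ for all $x,y\in M$; $M$ is graded iff it can be equipped with a gradation. $M$ is unidecomposable iff for all $x,y,x',y'\in M$, $x+y=x'+y'$ implies $x=x'$ and $y=y'$. For a non-empty set $X$, put $X_1=X$ and $X_n=\bigcup_{k=1}^{n-1}X_k\times X_{n-k}$ for $n>1$ (the sets $X_n$ being pairwise disjoint); the free magma on $X$ is $\mathbb{M}_X=\bigcup_{n\ge1}X_n$ with $x+y=(x,y)$. A magma $M$ is free iff there is some set $X$ such that $M\cong\mathbb{M}_X$.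
   Formalization: The generating set X is allowed to be empty, so the empty magma counts as free; with X required to be non-empty, the empty magma is vacuously graded and unidecomposable but not free. For non-empty M nothing changes. *)

theory Defs
  imports Main
begin

locale magma =
  fixes M :: "'a set" and add :: "'a \<Rightarrow> 'a \<Rightarrow> 'a"
  assumes add_closed: "x \<in> M \<Longrightarrow> y \<in> M \<Longrightarrow> add x y \<in> M"

definition gradation :: "'a set \<Rightarrow> ('a \<Rightarrow> 'a \<Rightarrow> 'a) \<Rightarrow> ('a \<Rightarrow> nat) \<Rightarrow> bool" where
  "gradation M add l \<longleftrightarrow>
     (\<forall>x\<in>M. 0 < l x) \<and> (\<forall>x\<in>M. \<forall>y\<in>M. l (add x y) = l x + l y)"

definition graded :: "'a set \<Rightarrow> ('a \<Rightarrow> 'a \<Rightarrow> 'a) \<Rightarrow> bool" where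
  "graded M add \<longleftrightarrow> (\<exists>l. gradation M add l)"

definition unidecomposable :: "'a set \<Rightarrow> ('a \<Rightarrow> 'a \<Rightarrow> 'a) \<Rightarrow> bool" where
  "unidecomposable M add \<longleftrightarrow>
     (\<forall>x\<in>M. \<forall>y\<in>M. \<forall>x'\<in>M. \<forall>y'\<in>M. add x y = add x' y' \<longrightarrow> x = x' \<and> y = y')"

definition magma_isomorphic ::
  "'a set \<Rightarrow> ('a \<Rightarrow> 'a \<Rightarrow> 'a) \<Rightarrow> 'b set \<Rightarrow> ('b \<Rightarrow> 'b \<Rightarrow> 'b) \<Rightarrow> bool" where
  "magma_isomorphic M add N add' \<longleftrightarrow>
     (\<exists>h. bij_betw h M N \<and> (\<forall>x\<in>M. \<forall>y\<in>M. h (add x y) = add' (h x) (h y)))"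

text \<open>
  The iterated products \<open>X\<^sub>n\<close> live in different types, so they are embedded in one type of
  nested pairs: \<open>Gen\<close> is the inclusion of \<open>X = X\<^sub>1\<close> and \<open>MPair x y\<close>
  is the ordered pair \<open>(x, y)\<close>. The constructors make the \<open>X\<^sub>n\<close> pairwise disjoint.
\<close>

datatype 'x nested = Gen 'x | MPair "'x nested" "'x nested"

text \<open>\<open>layer X n\<close> is \<open>X\<^sub>n\<close>; indices start at 1, and \<open>layer X 0\<close> is empty.\<close>

function layer :: "'x set \<Rightarrow> nat \<Rightarrow> 'x nested set" where
  "layer X n =
     (if n = 1 then Gen ` X
      else (\<Union>k\<in>{1..<n}. (\<lambda>(x, y). MPair x y) ` (layer X k \<times> layer X (n - k))))"
  by auto
termination
  by (relation "measure snd") auto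

declare layer.simps [simp del]

definition free_magma_carrier :: "'x set \<Rightarrow> 'x nested set" where
  "free_magma_carrier X = (\<Union>n\<in>{1..}. layer X n)"

text \<open>
  The generating set \<open>X\<close> is taken in the type of the elements of \<open>M\<close>; lemma \<open>free_magmaI\<close>
  below shows that generating sets in other types give nothing new. \<open>X\<close> may be empty, which
  only adds the empty magma; see \<open>free_magma_nonempty_iff\<close>.
\<close>

definition free_magma :: "'a set \<Rightarrow> ('a \<Rightarrow> 'a \<Rightarrow> 'a) \<Rightarrow> bool" where
  "free_magma M add \<longleftrightarrow> (\<exists>X :: 'a set. magma_isomorphic M add (free_magma_carrier X) MPair)"

primrec leaves :: "'x nested \<Rightarrow> nat" where
  "leaves (Gen x) = 1"
| "leaves (MPair t u) = leaves t + leaves u"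

lemma leaves_pos [simp]: "0 < leaves t"
  by (induction t) auto

lemma leaves_neq_0 [simp]: "leaves t \<noteq> 0"
  using leaves_pos[of t] by simp

lemma layer_eq: "layer X n = {t. set_nested t \<subseteq> X \<and> leaves t = n}"
proof (induction n rule: less_induct)
  case (less n)
  show ?case
  proof (cases "n = 1")
    case True
    have "layer X 1 = Gen ` X"
      by (subst layer.simps) simp
    moreover have "t \<in> Gen ` X \<longleftrightarrow> set_nested t \<subseteq> X \<and> leaves t = 1" for t
    proof (cases t)
      case (MPair u v)
      have "leaves u + leaves v \<noteq> 1"
        using leaves_pos[of u] leaves_pos[of v] by linarith
      then show ?thesis using MPair by auto
    qed auto
    ultimately have "layer X 1 = {t. set_nested t \<subseteq> X \<and> leaves t = 1}"
      by blast
    then show ?thesis using True by simp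
  next
    case False
    have "layer X n = (\<Union>k\<in>{1..<n}. (\<lambda>(x, y). MPair x y) ` (layer X k \<times> layer X (n - k)))"
      using False by (subst layer.simps) simp
    also have "\<dots> = (\<Union>k\<in>{1..<n}. (\<lambda>(x, y). MPair x y) `
        ({t. set_nested t \<subseteq> X \<and> leaves t = k} \<times> {t. set_nested t \<subseteq> X \<and> leaves t = n - k}))"
      by (intro SUP_cong refl) (simp add: less)
    also have "\<dots> = {t. set_nested t \<subseteq> X \<and> leaves t = n}" (is "?L = ?R")
    proof -
      have "t \<in> ?L \<longleftrightarrow> t \<in> ?R" for t
      proof (cases t)
        case (Gen x)
        then show ?thesis using False by auto
      next
        case (MPair x y)
        have "t \<in> ?L" if "t \<in> ?R"
        proof (rule UN_I)
          show "leaves x \<in> {1..<n}"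
            using that MPair by (auto simp: Suc_le_eq)
          show "t \<in> (\<lambda>(x, y). MPair x y) `
              ({u. set_nested u \<subseteq> X \<and> leaves u = leaves x} \<times>
               {u. set_nested u \<subseteq> X \<and> leaves u = n - leaves x})"
            using that MPair by (intro image_eqI[of _ _ "(x, y)"]) auto
        qed
        moreover have "t \<in> ?R" if "t \<in> ?L"
        proof -
          from that MPair obtain k where "k < n"
            "set_nested x \<subseteq> X" "leaves x = k" "set_nested y \<subseteq> X" "leaves y = n - k"
            by auto
          then show ?thesis using MPair by simp
        qed
        ultimately show ?thesis by blast
      qed
      then show ?thesis by blast
    qed
    finally show ?thesis .
  qed
qed

lemma layer_disjoint: "m \<noteq> n \<Longrightarrow> layer X m \<inter> layer X n = {}"
  by (auto simp: layer_eq)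

lemma free_magma_carrier_eq: "free_magma_carrier X = {t. set_nested t \<subseteq> X}"
  by (auto simp: free_magma_carrier_def layer_eq Suc_le_eq)

lemma magma_free_magma_carrier: "magma (free_magma_carrier X) MPair"
  by standard (auto simp: free_magma_carrier_eq)

lemma free_magma_carrier_map:
  "free_magma_carrier (f ` X) = map_nested f ` free_magma_carrier X"
proof -
  have "t \<in> map_nested f ` {t. set_nested t \<subseteq> X}" if "set_nested t \<subseteq> f ` X" for t
    using that
  proof (induction t)
    case (Gen y)
    then obtain x where "x \<in> X" "y = f x" by auto
    then show ?case by (auto intro!: image_eqI[of _ _ "Gen x"])
  next
    case (MPair t u)
    then obtain t' u' where "set_nested t' \<subseteq> X" "t = map_nested f t'"
      "set_nested u' \<subseteq> X" "u = map_nested f u'" by auto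
    then show ?case by (auto intro!: image_eqI[of _ _ "MPair t' u'"])
  qed
  moreover have "set_nested (map_nested f t) \<subseteq> f ` X" if "set_nested t \<subseteq> X" for t
    using that by (simp add: nested.set_map image_mono)
  ultimately show ?thesis unfolding free_magma_carrier_eq by blast
qed

lemma inj_on_map_nested:
  assumes "inj_on f X"
  shows "inj_on (map_nested f) (free_magma_carrier X)"
proof (rule inj_onI)
  fix t u
  assume "t \<in> free_magma_carrier X" "u \<in> free_magma_carrier X" "map_nested f t = map_nested f u"
  then show "t = u"
    using assms by (intro nested.inj_map_strong[of t u f f])
      (auto simp: free_magma_carrier_eq inj_on_def subset_iff)
qed

lemma free_magmaI:
  fixes X :: "'b set"
  assumes "magma M add" and "magma_isomorphic M add (free_magma_carrier X) MPair"
  shows "free_magma M add"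
proof -
  obtain h where h: "bij_betw h M (free_magma_carrier X)"
    and hom: "\<And>x y. x \<in> M \<Longrightarrow> y \<in> M \<Longrightarrow> h (add x y) = MPair (h x) (h y)"
    using assms(2) by (auto simp: magma_isomorphic_def)
  define e where "e x = inv_into M h (Gen x)" for x
  have "h (e x) = Gen x" if "x \<in> X" for x
    unfolding e_def using h that
    by (intro bij_betw_inv_into_right) (auto simp: free_magma_carrier_eq)
  then have "inj_on e X" by (metis inj_onI nested.inject(1))
  then have "bij_betw (map_nested e) (free_magma_carrier X) (free_magma_carrier (e ` X))"
    by (simp add: bij_betw_def inj_on_map_nested free_magma_carrier_map)
  then have "bij_betw (map_nested e \<circ> h) M (free_magma_carrier (e ` X))"
    using h by (rule bij_betw_trans[rotated])
  then show ?thesis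
    unfolding free_magma_def magma_isomorphic_def
    by (intro exI[of _ "e ` X"] exI[of _ "map_nested e \<circ> h"]) (auto simp: hom)
qed

lemma free_magma_nonempty_iff:
  fixes M :: "'a set"
  assumes "M \<noteq> {}"
  shows "free_magma M add \<longleftrightarrow>
    (\<exists>X :: 'a set. X \<noteq> {} \<and> magma_isomorphic M add (free_magma_carrier X) MPair)"
proof -
  have "set_nested t \<noteq> {}" for t :: "'a nested"
    by (induction t) auto
  then have "free_magma_carrier ({} :: 'a set) = {}"
    by (auto simp: free_magma_carrier_eq)
  then have "X \<noteq> {}" if "magma_isomorphic M add (free_magma_carrier X) MPair" for X :: "'a set"
    using that assms by (auto simp: magma_isomorphic_def bij_betw_def)
  then show ?thesis
    unfolding free_magma_def by blast
qed

end

(* The leaf count grades a free magma. Conversely, a graded unidecomposable magma is freely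
   generated by its indecomposable elements: evaluation of nested pairs of indecomposables is
   surjective by induction on the degree, since a proper sum has summands of smaller degree, and
   injective because decompositions are unique. *)

theory Submission
  imports Defs
begin

text \<open>The homomorphism from the universal property of the free magma: on nested pairs over
  \<open>X \<subseteq> M\<close> it extends the inclusion of \<open>X\<close> into
  \<open>M\<close>.\<close>

primrec eval_nested :: "('a \<Rightarrow> 'a \<Rightarrow> 'a) \<Rightarrow> 'a nested \<Rightarrow> 'a" where
  "eval_nested add (Gen x) = x"
| "eval_nested add (MPair t u) = add (eval_nested add t) (eval_nested add u)"

text \<open>The only candidate for a free generating set: an isomorphism onto a free magma sends
  sums to \<open>MPair\<close> terms, so exactly the non-sums can correspond to \<open>Gen\<close>
  terms.\<close>

definition indecomposables :: "'a set \<Rightarrow> ('a \<Rightarrow> 'a \<Rightarrow> 'a) \<Rightarrow> 'a set" where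
  "indecomposables M add = M - {add x y | x y. x \<in> M \<and> y \<in> M}"

lemma MPair_in_free_magma_carrier_iff [simp]:
  "MPair t u \<in> free_magma_carrier X \<longleftrightarrow> t \<in> free_magma_carrier X \<and> u \<in> free_magma_carrier X"
  by (auto simp: free_magma_carrier_eq)

lemma Gen_in_free_magma_carrier_iff [simp]: "Gen x \<in> free_magma_carrier X \<longleftrightarrow> x \<in> X"
  by (auto simp: free_magma_carrier_eq)

lemma graded_if_free_magma:
  fixes M :: "'a set"
  assumes "free_magma M add"
  shows "graded M add"
proof -
  obtain h :: "'a \<Rightarrow> 'a nested" where "\<forall>x\<in>M. \<forall>y\<in>M. h (add x y) = MPair (h x) (h y)"
    using assms by (auto simp: free_magma_def magma_isomorphic_def)
  then have "gradation M add (leaves \<circ> h)"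
    by (simp add: gradation_def)
  then show ?thesis
    by (auto simp: graded_def)
qed

text \<open>The constructor \<open>MPair\<close> is injective, and the injectivity of
  \<open>h\<close> carries this back to \<open>M\<close>.\<close>

lemma unidecomposable_if_free_magma:
  fixes M :: "'a set"
  assumes "free_magma M add"
  shows "unidecomposable M add"
proof -
  obtain h :: "'a \<Rightarrow> 'a nested" where "inj_on h M" "\<forall>x\<in>M. \<forall>y\<in>M. h (add x y) = MPair (h x) (h y)"
    using assms by (auto simp: free_magma_def magma_isomorphic_def bij_betw_def)
  then show ?thesis
    unfolding unidecomposable_def by (metis inj_onD nested.inject(2))
qed

context magma
begin

lemma eval_nested_closed:
  "X \<subseteq> M \<Longrightarrow> t \<in> free_magma_carrier X \<Longrightarrow> eval_nested add t \<in> M"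
  by (induction t) (auto intro: add_closed)

lemma eval_nested_indecomposables_closed:
  "t \<in> free_magma_carrier (indecomposables M add) \<Longrightarrow> eval_nested add t \<in> M"
  by (rule eval_nested_closed) (auto simp: indecomposables_def)

lemma add_notin_indecomposables:
  "x \<in> M \<Longrightarrow> y \<in> M \<Longrightarrow> add x y \<notin> indecomposables M add"
  by (auto simp: indecomposables_def)

text \<open>A \<open>Gen\<close> and an \<open>MPair\<close> never have the same value, since one
  value is indecomposable and the other is a sum. For two pairs, unidecomposability splits the
  equation into equations between the components.\<close>

lemma inj_on_eval_nested:
  assumes "unidecomposable M add"
  shows "inj_on (eval_nested add) (free_magma_carrier (indecomposables M add))"
proof (rule inj_onI)
  fix t u
  assume "t \<in> free_magma_carrier (indecomposables M add)"
    "u \<in> free_magma_carrier (indecomposables M add)" "eval_nested add t = eval_nested add u"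
  then show "t = u"
  \<comment> \<open>The term \<open>u\<close> must vary, because the induction hypotheses are
    applied to its components \<open>u1\<close> and \<open>u2\<close>.\<close>
  proof (induction t arbitrary: u)
    case (Gen x)
    then show ?case
      by (cases u) (auto simp: add_notin_indecomposables eval_nested_indecomposables_closed)
  next
    case (MPair t1 t2)
    show ?case
    proof (cases u)
      case (Gen x)
      then show ?thesis
        using MPair.prems
        by (auto simp: add_notin_indecomposables eval_nested_indecomposables_closed)
    next
      case u: (MPair u1 u2)
      have "eval_nested add t1 = eval_nested add u1 \<and> eval_nested add t2 = eval_nested add u2"
        using assms[unfolded unidecomposable_def, rule_format,
            of "eval_nested add t1" "eval_nested add t2" "eval_nested add u1" "eval_nested add u2"]
          MPair.prems u
        by (simp add: eval_nested_indecomposables_closed)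
      then show ?thesis
        using MPair u by simp
    qed
  qed
qed

lemma eval_nested_surj:
  assumes "gradation M add l" "x \<in> M"
  shows "x \<in> eval_nested add ` free_magma_carrier (indecomposables M add)"
  using assms(2)
proof (induction "l x" arbitrary: x rule: less_induct)
  case less
  show ?case
  proof (cases "x \<in> indecomposables M add")
    case True
    then show ?thesis
      by (intro image_eqI[of _ _ "Gen x"]) simp_all
  next
    case False
    then obtain y z where yz: "y \<in> M" "z \<in> M" "x = add y z"
      using less.prems by (auto simp: indecomposables_def)
    \<comment> \<open>Degrees are strictly positive, so each summand has smaller degree than the
      sum.\<close>
    then have "l y < l x" "l z < l x"
      using assms(1) by (auto simp: gradation_def)
    then obtain t u where
      "t \<in> free_magma_carrier (indecomposables M add)" "y = eval_nested add t"
      "u \<in> free_magma_carrier (indecomposables M add)" "z = eval_nested add u"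
      using less.hyps yz by blast
    then show ?thesis
      using yz by (intro image_eqI[of _ _ "MPair t u"]) simp_all
  qed
qed

lemma free_magma_if_graded_unidecomposable:
  assumes "graded M add" "unidecomposable M add"
  shows "free_magma M add"
proof -
  let ?F = "free_magma_carrier (indecomposables M add)"
  \<comment> \<open>Evaluation maps terms to \<open>M\<close>, whereas
    \<open>magma_isomorphic\<close> asks for a map from \<open>M\<close> to terms.\<close>
  let ?h = "inv_into ?F (eval_nested add)"
  have bij: "bij_betw (eval_nested add) ?F M"
    using assms inj_on_eval_nested eval_nested_surj eval_nested_indecomposables_closed
    by (auto simp: bij_betw_def graded_def)
  \<comment> \<open>Both sides are terms in \<open>?F\<close> with value \<open>add x y\<close>, so
    they agree by injectivity of evaluation.\<close>
  have "?h (add x y) = MPair (?h x) (?h y)" if "x \<in> M" "y \<in> M" for x y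
  proof -
    have "?h x \<in> ?F" "?h y \<in> ?F"
      using bij_betw_inv_into[OF bij] that by (auto dest: bij_betwE)
    moreover have "eval_nested add (MPair (?h x) (?h y)) = add x y"
      using that bij by (simp add: bij_betw_inv_into_right)
    ultimately show ?thesis
      using bij by (metis MPair_in_free_magma_carrier_iff bij_betw_inv_into_left)
  qed
  then show ?thesis
    using bij_betw_inv_into[OF bij] unfolding free_magma_def magma_isomorphic_def by blast
qed

end

theorem theorem2p4:
  fixes M :: "'a set" and add :: "'a \<Rightarrow> 'a \<Rightarrow> 'a"
  assumes "magma M add"
  shows "free_magma M add \<longleftrightarrow> graded M add \<and> unidecomposable M add"
  using graded_if_free_magma unidecomposable_if_free_magma
    magma.free_magma_if_graded_unidecomposable[OF assms] by blast

end
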